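(* For any finite simple graph $H$ and any edge $e\in E(H)$ we have $$\frac{\mathrm{wr}(H)}{\mathrm{wr}(H-e)}\geq\frac{7}{9}.$$
   Context: $\mathrm{wr}(H)$ denotes the number of Widom-Rowlinson configurations of $H$: the number of maps $\phi:V(H)\to\{a,b,c\}$ (colors red, white, blue respectively) such that no edge of $H$ has one endpoint colored $a$ and the other colored $c$. Equivalently, $\mathrm{wr}(H)$ is the number of homomorphisms from $H$ to the graph $P_3^{\circ}$, the path $a-b-c$ on three vertices with a loop added at each vertex. $H-e$ is the graph with vertex set $V(H)$ and edge set $E(H)\setminus\{e\}$. *)

theory Defs
  imports Complex_Main "HOL-Library.FuncSet"
begin

locale finite_simple_graph =
  fixes V :: "'a set" and E :: "'a set set"
  assumes finite_V: "finite V"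
    and edges: "e \<in> E \<Longrightarrow> e \<subseteq> V \<and> card e = 2"

datatype wr_colour = Red | White | Blue

text \<open>
  Colourings are extensional functions (\<open>undefined\<close> outside \<open>V\<close>), so that each map on \<open>V\<close> is counted
  once. Since \<open>{u, v} = {v, u}\<close>, the condition below covers both orientations of an edge.
\<close>

definition wr_configs :: "'a set \<Rightarrow> 'a set set \<Rightarrow> ('a \<Rightarrow> wr_colour) set" where
  "wr_configs V E =
     {\<phi> \<in> V \<rightarrow>\<^sub>E UNIV. \<forall>u v. {u, v} \<in> E \<longrightarrow> \<not> (\<phi> u = Red \<and> \<phi> v = Blue)}"

definition wr :: "'a set \<Rightarrow> 'a set set \<Rightarrow> nat" where
  "wr V E = card (wr_configs V E)"

lemma UNIV_wr_colour: "(UNIV :: wr_colour set) = {Red, White, Blue}"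
  using wr_colour.exhaust by auto

lemma (in finite_simple_graph) wr_pos: "wr V E > 0"
proof -
  have "finite (wr_configs V E)"
    by (rule finite_subset[of _ "V \<rightarrow>\<^sub>E UNIV"])
       (auto simp: wr_configs_def UNIV_wr_colour intro!: finite_PiE finite_V)
  moreover have "restrict (\<lambda>_. White) V \<in> wr_configs V E"
  proof -
    have "u \<in> V" if "{u, v} \<in> E" for u v using edges[OF that] by auto
    then show ?thesis by (auto simp: wr_configs_def restrict_def)
  qed
  ultimately show ?thesis unfolding wr_def by (auto simp: card_gt_0_iff)
qed

end

theory Submission
  imports Defs
begin

text \<open>
  Let \<open>e = {u, v}\<close>, and let \<open>N x y\<close> be the number of configurations of \<open>H - e\<close> in which \<open>u\<close> has
  colour \<open>x\<close> and \<open>v\<close> has colour \<open>y\<close>. Deleting \<open>e\<close> admits exactly the configurations counted by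
  \<open>N Red Blue + N Blue Red\<close>, so it suffices that \<open>N Red Blue\<close> is minimal among the nine numbers
  \<open>N x y\<close>. Whitening a vertex never destroys validity, and exchanging red and blue everywhere is
  a symmetry. The remaining inequality \<open>N Red Blue \<le> N Red Red\<close> follows by exchanging red and blue
  on the connected component of \<open>v\<close> in the subgraph induced by the non-white vertices; this is
  injective because it does not change which vertices are white.
\<close>

fun swap_colour :: "wr_colour \<Rightarrow> wr_colour" where
  "swap_colour Red = Blue"
| "swap_colour White = White"
| "swap_colour Blue = Red"

lemma swap_colour_swap_colour [simp]: "swap_colour (swap_colour x) = x"
  by (cases x) auto

lemma swap_colour_eq_iff [simp]:
  "swap_colour x = Red \<longleftrightarrow> x = Blue"
  "swap_colour x = White \<longleftrightarrow> x = White"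
  "swap_colour x = Blue \<longleftrightarrow> x = Red"
  by (cases x; simp)+

definition flip_on :: "'a set \<Rightarrow> ('a \<Rightarrow> wr_colour) \<Rightarrow> 'a \<Rightarrow> wr_colour" where
  "flip_on S \<phi> = (\<lambda>w. if w \<in> S then swap_colour (\<phi> w) else \<phi> w)"

lemma flip_on_flip_on [simp]: "flip_on S (flip_on S \<phi>) = \<phi>"
  by (auto simp: flip_on_def)

lemma flip_on_eq_White_iff [simp]: "flip_on S \<phi> w = White \<longleftrightarrow> \<phi> w = White"
  by (simp add: flip_on_def)

definition nonwhite_adj :: "'a set set \<Rightarrow> ('a \<Rightarrow> wr_colour) \<Rightarrow> ('a \<times> 'a) set" where
  "nonwhite_adj F \<phi> = {(x, y). {x, y} \<in> F \<and> \<phi> x \<noteq> White \<and> \<phi> y \<noteq> White}"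

text \<open>The relation depends on the colouring only through its set of white vertices, which a
  flip preserves.\<close>

lemma nonwhite_adj_flip_on [simp]: "nonwhite_adj F (flip_on S \<phi>) = nonwhite_adj F \<phi>"
  by (simp add: nonwhite_adj_def)

definition nonwhite_component :: "'a set set \<Rightarrow> ('a \<Rightarrow> wr_colour) \<Rightarrow> 'a \<Rightarrow> 'a set" where
  "nonwhite_component F \<phi> v = (nonwhite_adj F \<phi>)\<^sup>* `` {v}"

lemma nonwhite_component_flip_on [simp]:
  "nonwhite_component F (flip_on S \<phi>) v = nonwhite_component F \<phi> v"
  by (simp add: nonwhite_component_def)

lemma self_in_nonwhite_component: "v \<in> nonwhite_component F \<phi> v"
  by (simp add: nonwhite_component_def)

lemma nonwhite_component_closed:
  assumes "x \<in> nonwhite_component F \<phi> v" "(x, y) \<in> nonwhite_adj F \<phi>"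
  shows "y \<in> nonwhite_component F \<phi> v"
  using assms by (auto simp: nonwhite_component_def intro: rtrancl_into_rtrancl)

lemma wr_configs_edge:
  assumes "\<phi> \<in> wr_configs V F" "{x, y} \<in> F"
  shows "\<not> (\<phi> x = Red \<and> \<phi> y = Blue)" "\<not> (\<phi> x = Blue \<and> \<phi> y = Red)"
  using assms by (auto simp: wr_configs_def insert_commute)

text \<open>An edge between non-white vertices cannot join red to blue, so the colour of
  \<open>v\<close> spreads along every non-white path. This keeps a red \<open>u\<close> out of the
  component of a blue \<open>v\<close>.\<close>

lemma nonwhite_component_Blue:
  assumes "\<phi> \<in> wr_configs V F" "\<phi> v = Blue" "w \<in> nonwhite_component F \<phi> v"
  shows "\<phi> w = Blue"
proof -
  have "(v, w) \<in> (nonwhite_adj F \<phi>)\<^sup>*"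
    using assms(3) by (simp add: nonwhite_component_def)
  then show ?thesis
  proof induction
    case (step x y)
    then have "{x, y} \<in> F" "\<phi> y \<noteq> White"
      by (auto simp: nonwhite_adj_def)
    with wr_configs_edge(2)[OF assms(1)] step.IH show ?case
      by (cases "\<phi> y") auto
  qed (fact assms(2))
qed

text \<open>An edge violated after the flip has two non-white ends, so closedness puts both or
  neither in \<open>S\<close>; it was then violated before. Stated for general \<open>S\<close> to
  serve both \<open>S = V\<close> and a single component.\<close>

lemma flip_on_in_wr_configs:
  assumes \<phi>: "\<phi> \<in> wr_configs V F" and "S \<subseteq> V"
    and closed: "\<And>x y. x \<in> S \<Longrightarrow> (x, y) \<in> nonwhite_adj F \<phi> \<Longrightarrow> y \<in> S"
  shows "flip_on S \<phi> \<in> wr_configs V F"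
proof -
  have "\<not> (flip_on S \<phi> x = Red \<and> flip_on S \<phi> y = Blue)" if xy: "{x, y} \<in> F" for x y
  proof
    assume *: "flip_on S \<phi> x = Red \<and> flip_on S \<phi> y = Blue"
    then have "\<phi> x \<noteq> White" "\<phi> y \<noteq> White"
      by (metis flip_on_eq_White_iff wr_colour.distinct(1,5))+
    then have "(x, y) \<in> nonwhite_adj F \<phi>" "(y, x) \<in> nonwhite_adj F \<phi>"
      using xy by (auto simp: nonwhite_adj_def insert_commute)
    then have "x \<in> S \<longleftrightarrow> y \<in> S"
      using closed by blast
    with * wr_configs_edge[OF \<phi> xy] show False
      by (auto simp: flip_on_def split: if_splits)
  qed
  moreover have "flip_on S \<phi> \<in> V \<rightarrow>\<^sub>E UNIV"
    using \<phi> \<open>S \<subseteq> V\<close> by (auto simp: wr_configs_def flip_on_def PiE_iff extensional_def)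
  ultimately show ?thesis
    by (simp add: wr_configs_def)
qed

lemma fun_upd_White_in_wr_configs:
  assumes "\<phi> \<in> wr_configs V F" "v \<in> V"
  shows "\<phi>(v := White) \<in> wr_configs V F"
  using assms by (auto simp: wr_configs_def PiE_iff extensional_def)

lemma finite_wr_configs:
  assumes "finite V"
  shows "finite (wr_configs V F)"
  by (rule finite_subset[of _ "V \<rightarrow>\<^sub>E UNIV"])
     (auto simp: wr_configs_def UNIV_wr_colour intro!: finite_PiE assms)

definition wr_configs_at :: "'a set \<Rightarrow> 'a set set \<Rightarrow> 'a \<Rightarrow> 'a \<Rightarrow> wr_colour \<Rightarrow> wr_colour \<Rightarrow> ('a \<Rightarrow> wr_colour) set"
  where "wr_configs_at V F u v x y = {\<phi> \<in> wr_configs V F. \<phi> u = x \<and> \<phi> v = y}"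

lemma finite_wr_configs_at: "finite V \<Longrightarrow> finite (wr_configs_at V F u v x y)"
  by (simp add: wr_configs_at_def finite_wr_configs)

lemma card_wr_configs_at_commute:
  "card (wr_configs_at V F u v x y) = card (wr_configs_at V F v u y x)"
  by (simp add: wr_configs_at_def conj_commute)

lemma card_wr_configs_at_White_right:
  assumes "finite V" "v \<in> V" "u \<noteq> v"
  shows "card (wr_configs_at V F u v x y) \<le> card (wr_configs_at V F u v x White)"
proof (rule card_inj_on_le)
  show "inj_on (\<lambda>\<phi>. \<phi>(v := White)) (wr_configs_at V F u v x y)"
    \<comment> \<open>The erased colour is the same \<open>y\<close> throughout the class, so it can
      be restored.\<close>
    by (rule inj_on_inverseI[where g = "\<lambda>\<phi>. \<phi>(v := y)"]) (auto simp: wr_configs_at_def)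
  show "(\<lambda>\<phi>. \<phi>(v := White)) ` wr_configs_at V F u v x y \<subseteq> wr_configs_at V F u v x White"
    using assms(2,3) fun_upd_White_in_wr_configs by (fastforce simp: wr_configs_at_def)
qed (rule finite_wr_configs_at[OF assms(1)])

lemma card_wr_configs_at_White_left:
  assumes "finite V" "u \<in> V" "u \<noteq> v"
  shows "card (wr_configs_at V F u v x y) \<le> card (wr_configs_at V F u v White y)"
  using card_wr_configs_at_White_right[of V u v F y x] assms
  by (simp add: card_wr_configs_at_commute[of V F u v])

text \<open>Flipping all of \<open>V\<close> is an involution on configurations.\<close>

lemma card_wr_configs_at_swap_colour:
  assumes "finite V" "\<Union>F \<subseteq> V" "u \<in> V" "v \<in> V"
  shows "card (wr_configs_at V F u v x y)
       \<le> card (wr_configs_at V F u v (swap_colour x) (swap_colour y))"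
proof (rule card_inj_on_le)
  show "inj_on (flip_on V) (wr_configs_at V F u v x y)"
    by (rule inj_on_inverseI[where g = "flip_on V"]) simp
  have "flip_on V \<phi> \<in> wr_configs V F" if "\<phi> \<in> wr_configs V F" for \<phi>
    using that assms(2) by (intro flip_on_in_wr_configs) (auto simp: nonwhite_adj_def)
  then show "flip_on V ` wr_configs_at V F u v x y
      \<subseteq> wr_configs_at V F u v (swap_colour x) (swap_colour y)"
    using assms(3,4) by (auto simp: wr_configs_at_def flip_on_def)
qed (rule finite_wr_configs_at[OF assms(1)])

lemma card_wr_configs_at_Red_Blue_le_Red_Red:
  assumes "finite V" "\<Union>F \<subseteq> V" "v \<in> V"
  shows "card (wr_configs_at V F u v Red Blue) \<le> card (wr_configs_at V F u v Red Red)"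
proof (rule card_inj_on_le)
  let ?f = "\<lambda>\<phi>. flip_on (nonwhite_component F \<phi> v) \<phi>"
  show "inj_on ?f (wr_configs_at V F u v Red Blue)"
    \<comment> \<open>The flipped colouring has the same component at \<open>v\<close>, so
      \<open>?f\<close> undoes itself.\<close>
    by (rule inj_on_inverseI[where g = ?f]) simp
  show "?f ` wr_configs_at V F u v Red Blue \<subseteq> wr_configs_at V F u v Red Red"
  proof (rule image_subsetI)
    fix \<phi> assume "\<phi> \<in> wr_configs_at V F u v Red Blue"
    then have \<phi>: "\<phi> \<in> wr_configs V F" "\<phi> u = Red" "\<phi> v = Blue"
      by (auto simp: wr_configs_at_def)
    have "nonwhite_component F \<phi> v \<subseteq> V"
    proof
      fix w assume "w \<in> nonwhite_component F \<phi> v"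
      then have "(v, w) \<in> (nonwhite_adj F \<phi>)\<^sup>*"
        by (simp add: nonwhite_component_def)
      then show "w \<in> V"
        by induction (use assms(2,3) in \<open>auto simp: nonwhite_adj_def\<close>)
    qed
    then have "?f \<phi> \<in> wr_configs V F"
      using \<phi>(1) nonwhite_component_closed by (intro flip_on_in_wr_configs)
    moreover have "u \<notin> nonwhite_component F \<phi> v"
      using nonwhite_component_Blue[OF \<phi>(1,3)] \<phi>(2) by auto
    ultimately show "?f \<phi> \<in> wr_configs_at V F u v Red Red"
      using \<phi> by (simp add: wr_configs_at_def flip_on_def self_in_nonwhite_component)
  qed
qed (rule finite_wr_configs_at[OF assms(1)])

lemma card_wr_configs_at_Red_Blue_minimal:
  assumes V: "finite V" "\<Union>F \<subseteq> V" "u \<in> V" "v \<in> V" "u \<noteq> v"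
  shows "card (wr_configs_at V F u v Red Blue) \<le> card (wr_configs_at V F u v x y)"
proof -
  let ?N = "\<lambda>x y. card (wr_configs_at V F u v x y)"
  note swap = card_wr_configs_at_swap_colour[OF V(1-4)]
  have "?N Red Blue \<le> ?N Red White" "?N Red Blue \<le> ?N White Blue" "?N Red White \<le> ?N White White"
    by (rule card_wr_configs_at_White_right[OF V(1,4,5)] card_wr_configs_at_White_left[OF V(1,3,5)])+
  moreover have "?N Red Blue \<le> ?N Red Red"
    by (rule card_wr_configs_at_Red_Blue_le_Red_Red[OF V(1,2,4)])
  moreover have "?N Red Blue \<le> ?N Blue Red" "?N Red White \<le> ?N Blue White"
      "?N White Blue \<le> ?N White Red" "?N Red Red \<le> ?N Blue Blue"
    using swap[of Red Blue] swap[of Red White] swap[of White Blue] swap[of Red Red] by simp_all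
  \<comment> \<open>The remaining colour pairs follow by chaining: \<open>White White\<close> and
    \<open>Blue White\<close> through \<open>Red White\<close>, \<open>White Red\<close> through
    \<open>White Blue\<close>, and \<open>Blue Blue\<close> through \<open>Red Red\<close>.\<close>
  ultimately show ?thesis
    by (cases x; cases y) auto
qed

text \<open>The nine colour pairs at \<open>u\<close> and \<open>v\<close> partition the
  configurations, and \<open>Red Blue\<close> is a smallest class.\<close>

lemma nine_card_wr_configs_at_Red_Blue_le_wr:
  assumes "finite V" "\<Union>F \<subseteq> V" "u \<in> V" "v \<in> V" "u \<noteq> v"
  shows "9 * card (wr_configs_at V F u v Red Blue) \<le> wr V F"
proof -
  let ?C = "UNIV :: wr_colour set" and ?N = "wr_configs_at V F u v"
  have C: "finite ?C" "card ?C = 3"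
    by (simp_all add: UNIV_wr_colour)
  have fin: "finite (?N x y)" for x y
    using assms(1) by (rule finite_wr_configs_at)
  have "wr V F = card (\<Union>x. \<Union>y. ?N x y)"
    unfolding wr_def by (rule arg_cong[where f = card]) (auto simp: wr_configs_at_def)
  also have "\<dots> = (\<Sum>x\<in>?C. card (\<Union>y. ?N x y))"
    using C(1) fin by (intro card_UN_disjoint) (auto simp: wr_configs_at_def)
  also have "\<dots> = (\<Sum>x\<in>?C. \<Sum>y\<in>?C. card (?N x y))"
    using C(1) fin by (intro sum.cong card_UN_disjoint) (auto simp: wr_configs_at_def)
  also have "\<dots> \<ge> (\<Sum>x\<in>?C. \<Sum>y\<in>?C. card (?N Red Blue))"
    by (intro sum_mono card_wr_configs_at_Red_Blue_minimal[OF assms])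
  finally show ?thesis
    by (simp add: C)
qed

theorem theorem1p5:
  fixes V :: "'a set" and E :: "'a set set" and e :: "'a set"
  assumes "finite_simple_graph V E"
    and "e \<in> E"
  shows "real (wr V E) / real (wr V (E - {e})) \<ge> 7 / 9"
proof -
  interpret finite_simple_graph V E by fact
  define F where "F = E - {e}"
  obtain u v where e: "e = {u, v}" and uv: "u \<noteq> v"
    using edges[OF assms(2)] by (meson card_2_iff)
  have V: "finite V" "\<Union>F \<subseteq> V" "u \<in> V" "v \<in> V"
    using finite_V edges edges[OF assms(2)] by (auto simp: F_def e)
  let ?A = "wr_configs_at V F u v Red Blue" and ?B = "wr_configs_at V F v u Red Blue"
  \<comment> \<open>A configuration of \<open>F\<close> that fails for \<open>E\<close> can fail
    only at \<open>e\<close>, in one of two orientations; \<open>?B\<close> has \<open>v\<close> red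
    and \<open>u\<close> blue.\<close>
  have "wr_configs V F \<subseteq> wr_configs V E \<union> (?A \<union> ?B)"
    by (auto simp: wr_configs_def wr_configs_at_def F_def e doubleton_eq_iff)
  then have "wr V F \<le> card (wr_configs V E \<union> (?A \<union> ?B))"
    unfolding wr_def
    by (intro card_mono) (simp_all add: V(1) finite_wr_configs finite_wr_configs_at)
  also have "\<dots> \<le> wr V E + (card ?A + card ?B)"
    unfolding wr_def by (meson add_left_mono card_Un_le order_trans)
  \<comment> \<open>Each of \<open>?A\<close> and \<open>?B\<close> is at most a ninth of
    \<open>wr V F\<close>, which leaves seven ninths for \<open>wr V E\<close>.\<close>
  finally have "7 * wr V F \<le> 9 * wr V E"
    using nine_card_wr_configs_at_Red_Blue_le_wr[OF V uv]
      nine_card_wr_configs_at_Red_Blue_le_wr[OF V(1,2,4,3) uv[symmetric]] by linarith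
  then have le: "7 * real (wr V F) \<le> 9 * real (wr V E)"
    by (metis of_nat_le_iff of_nat_mult of_nat_numeral)
  \<comment> \<open>This makes \<open>wr_pos\<close> available for \<open>F\<close>, so that the
    denominator is positive.\<close>
  interpret F: finite_simple_graph V F
    by unfold_locales (use finite_V edges in \<open>auto simp: F_def\<close>)
  show ?thesis
    using le F.wr_pos by (simp add: F_def field_simps)
qed

end
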